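(* Let $n \geq t \geq 1$ be integers and let $\mathcal{F} = 2^{[n]}$. Then \[\beta(\mathcal{F},t) = \frac{l(\mathcal{F},t)}{|\mathcal{F}|} = \frac{|\mathcal{K}_{n,t}|}{2^n},\] where $\mathcal{K}_{n,t} = \{A \subseteq [n] : |A| \geq (n+t)/2\}$ if $n+t$ is even, and $\mathcal{K}_{n,t} = \{A \subseteq [n] : |A \cap [n-1]| \geq (n+t-1)/2\}$ if $n+t$ is odd.
   Context: $[n] = \{1,\dots,n\}$ and $2^{[n]}$ is the family of all subsets of $[n]$. A family $\mathcal{A}$ is $t$-intersecting if $|A \cap B| \geq t$ for all $A, B \in \mathcal{A}$ with $A \neq B$; $l(\mathcal{F},t)$ is the size of a largest $t$-intersecting sub-family of $\mathcal{F}$. For a family $\mathcal{A}$, $\mathcal{A}^{t,+} = \{A \in \mathcal{A} : |A \cap B| \geq t \text{ for all } B \in \mathcal{A}\setminus\{A\}\}$ and $\mathcal{A}^{t,-} = \mathcal{A} \setminus \mathcal{A}^{t,+}$. For $\mathcal{A} \subseteq \mathcal{F}$, $\beta(\mathcal{F},t,\mathcal{A}) = \frac{l(\mathcal{F},t) - |\mathcal{A}^{t,+}|}{|\mathcal{A}^{t,-}|}$ if $\mathcal{A}^{t,-} \neq \emptyset$, and $\frac{l(\mathcal{F},t)}{|\mathcal{F}|}$ otherwise; $\beta(\mathcal{F},t) = \min_{\mathcal{A} \subseteq \mathcal{F}} \beta(\mathcal{F},t,\mathcal{A})$. *)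

theory Defs
  imports Complex_Main
begin

definition t_intersecting :: "nat \<Rightarrow> 'a set set \<Rightarrow> bool" where
  "t_intersecting t \<A> \<longleftrightarrow> (\<forall>A\<in>\<A>. \<forall>B\<in>\<A>. A \<noteq> B \<longrightarrow> card (A \<inter> B) \<ge> t)"

definition l_max :: "'a set set \<Rightarrow> nat \<Rightarrow> nat" where
  "l_max \<F> t = Max {card \<A> | \<A>. \<A> \<subseteq> \<F> \<and> t_intersecting t \<A>}"

definition fam_plus :: "'a set set \<Rightarrow> nat \<Rightarrow> 'a set set" where
  "fam_plus \<A> t = {A \<in> \<A>. \<forall>B \<in> \<A> - {A}. card (A \<inter> B) \<ge> t}"

definition fam_minus :: "'a set set \<Rightarrow> nat \<Rightarrow> 'a set set" where
  "fam_minus \<A> t = \<A> - fam_plus \<A> t"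

definition beta_sub :: "'a set set \<Rightarrow> nat \<Rightarrow> 'a set set \<Rightarrow> real" where
  "beta_sub \<F> t \<A> =
     (if fam_minus \<A> t \<noteq> {}
      then (real (l_max \<F> t) - real (card (fam_plus \<A> t))) / real (card (fam_minus \<A> t))
      else real (l_max \<F> t) / real (card \<F>))"

definition beta :: "'a set set \<Rightarrow> nat \<Rightarrow> real" where
  "beta \<F> t = Min {beta_sub \<F> t \<A> | \<A>. \<A> \<subseteq> \<F>}"

definition K_fam :: "nat \<Rightarrow> nat \<Rightarrow> nat set set" where
  "K_fam n t =
     (if even (n + t)
      then {A. A \<subseteq> {1..n} \<and> 2 * card A \<ge> n + t}
      else {A. A \<subseteq> {1..n} \<and> 2 * card (A \<inter> {1..n-1}) \<ge> n + t - 1})"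

end

(* Write k for the size of K_fam n t. For P = fam_plus A t and Q = A, no complement of a set of Q
   lies within Hamming distance t - 1 of P, so |Q| <= 2^n - |N(P)|, N(P) being the
   (t - 1)-neighbourhood of P. Everything then follows from (2^n - k) |P| <= k |N(P)|. The
   neighbourhood is bounded below through a piecewise linear profile f interpolating the sizes of
   Hamming balls, f(u) <= |P| implying f(u + 1) <= |N_1(P)|, which is proved by induction on the
   dimension from Pascal's rule f_(n+1)(u) = f_n(u) + f_n(u - 1). If n + t is odd, the doubled
   profile of dimension n - 1 satisfies the same inequality in dimension n, since the recursion
   does not see the base case. Log-concavity of f' gives the final ratio inequality, and
   the complement symmetry of f identifies the extremal family. *)

theory Submission
  imports Defs
begin

section \<open>The piecewise linear profile of Hamming ball sizes\<close>

text \<open>At an integer \<open>u\<close> the value is the sum of the binomials C(n, i) over i < u,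
  the size of a Hamming ball of radius u - 1, and it is linear in between. Real arguments let every
  cardinality occur as a value.\<close>

fun profile :: "nat \<Rightarrow> real \<Rightarrow> real" where
  "profile 0 u = max 0 (min 1 u)"
| "profile (Suc n) u = profile n u + profile n (u - 1)"

lemma profile_mono: "u \<le> v \<Longrightarrow> profile n u \<le> profile n v"
  by (induction n arbitrary: u v) (auto intro!: add_mono)

lemma profile_eq_0: "u \<le> 0 \<Longrightarrow> profile n u = 0"
  by (induction n arbitrary: u) auto

lemma profile_nonneg: "0 \<le> profile n u"
  by (induction n arbitrary: u) auto

text \<open>For integer u, the complement of a ball of radius u - 1 is the ball of radius n - u
  about the antipode, whose argument is n + 1 - u.\<close>

lemma profile_reflect: "profile n (real n + 1 - u) = 2 ^ n - profile n u"
proof (induction n arbitrary: u)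
  case (Suc n)
  have "real n + 2 - u = real n + 1 - (u - 1)" by simp
  then have "profile n (real n + 2 - u) = 2 ^ n - profile n (u - 1)"
    using Suc.IH by metis
  then show ?case using Suc.IH[of u] by (simp add: algebra_simps)
qed (auto simp: min_def max_def)

lemma profile_eq_power: "real n + 1 \<le> u \<Longrightarrow> profile n u = 2 ^ n"
  using profile_reflect[of n "real n + 1 - u"] profile_eq_0[of "real n + 1 - u" n] by simp

lemma isCont_profile: "isCont (profile n) u"
proof (induction n arbitrary: u)
  case 0
  have "profile 0 = (\<lambda>u. max 0 (min 1 u))" by auto
  then show ?case by (auto intro!: continuous_max continuous_min)
next
  case (Suc n)
  have "profile (Suc n) = (\<lambda>u. profile n u + profile n (u - 1))" by auto
  moreover have "isCont (\<lambda>u. profile n (u - 1)) u"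
    by (rule isCont_o2[where g = "profile n"]) (simp_all add: Suc.IH)
  ultimately show ?case using Suc.IH by (simp add: isCont_add)
qed

text \<open>Serves to replace set sizes by profile arguments, which can then be shifted and
  compared.\<close>

lemma profile_surj:
  assumes "0 \<le> p" "p \<le> 2 ^ n"
  obtains u where "profile n u = p"
  using IVT[of "profile n" 0 p "real n + 1"] assms
  by (auto simp: profile_eq_0 profile_eq_power isCont_profile)

text \<open>Log-concavity of the derivative of the profile, in integrated form: total positivity of
  order two survives the convolution step of the recursion.\<close>

lemma profile_increments:
  fixes k :: nat and u v w z :: real
  assumes "z \<le> w" "w \<le> v" "v \<le> u"
  shows "(profile n (u + k) - profile n (v + k)) * (profile n w - profile n z)
       \<le> (profile n u - profile n v) * (profile n (w + k) - profile n (z + k))"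
  using assms
proof (induction n arbitrary: z w v u k)
  case 0
  show ?case
  proof (cases "k = 0 \<or> w \<le> 0")
    case True
    moreover have "profile 0 w - profile 0 z = 0" if "w \<le> 0"
      using that 0 by (simp add: profile_eq_0)
    moreover have "0 \<le> profile 0 u - profile 0 v" "0 \<le> profile 0 (w + k) - profile 0 (z + k)"
      using 0 by (simp_all del: profile.simps add: profile_mono)
    ultimately show ?thesis by (auto simp del: profile.simps)
  next
    case False
    \<comment> \<open>Here \<open>k\<close> is at least 1 and v and u are positive, so both shifted
      points lie where \<open>profile 0\<close> is constantly 1.\<close>
    then have "profile 0 (u + k) - profile 0 (v + k) = 0"
      using 0 by simp
    moreover have "0 \<le> profile 0 u - profile 0 v" "0 \<le> profile 0 (w + k) - profile 0 (z + k)"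
      using 0 by (simp_all del: profile.simps add: profile_mono)
    ultimately show ?thesis by (simp del: profile.simps)
  qed
next
  case (Suc n)
  show ?case
  proof (cases k)
    case (Suc l)
    have shift: "x - 1 + real k = x + real l" "x - 1 + real (Suc k) = x + real k"
      "x + real k - 1 = x + real l" for x
      using Suc by auto
    \<comment> \<open>The recursion expands each side into four products. The aligned ones compare
      with shift \<open>k\<close>, the two mixed ones with shifts k + 1 and k - 1, which is why the
      shift varies in the induction. For k = 0 the two sides coincide.\<close>
    show ?thesis
      using Suc.IH[of z w v u k] Suc.IH[of "z - 1" "w - 1" "v - 1" "u - 1" k]
        Suc.IH[of "z - 1" "w - 1" "v - 1" "u - 1" "Suc k"] Suc.IH[of z w v u l] Suc.prems
      unfolding profile.simps shift
      by (simp add: algebra_simps)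
  qed simp
qed

text \<open>Numerical core of the isoperimetric induction: sections of sizes f(v) and f(w), less
  spread out than the sections f(u) and f(u - 1) of a ball, have neighbourhoods at least as large in
  total. By log-concavity, mass on the upper interval from v to u gains no larger a factor under the
  unit shift than mass on the lower interval from u - 1 to w, and there is no more of it.\<close>

lemma profile_exchange:
  assumes "w \<le> v" "v \<le> u" "profile n (u - 1) < profile n w"
    and "profile n u + profile n (u - 1) \<le> profile n v + profile n w"
  shows "profile n (u + 1) + profile n u \<le> profile n (v + 1) + profile n (w + 1)"
proof -
  define Y where "Y = profile n w - profile n (u - 1)"
  have "Y > 0" using assms(3) by (simp add: Y_def)
  have "u - 1 \<le> w"
    using assms(3) profile_mono[of w "u - 1" n] by linarith
  then have "(profile n (u + 1) - profile n (v + 1)) * Y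
      \<le> (profile n u - profile n v) * (profile n (w + 1) - profile n u)"
    using profile_increments[of "u - 1" w v u n 1] assms by (simp add: Y_def)
  also have "\<dots> \<le> Y * (profile n (w + 1) - profile n u)"
    using assms profile_mono[of u "w + 1" n] \<open>u - 1 \<le> w\<close>
    by (intro mult_right_mono) (auto simp: Y_def)
  finally show ?thesis
    using \<open>Y > 0\<close> by (simp add: mult.commute[of _ Y])
qed

lemma profile_ratio:
  fixes k :: nat and u v :: real
  assumes "u \<le> v"
  shows "profile n (v + k) * profile n u \<le> profile n v * profile n (u + k)"
proof -
  \<comment> \<open>The lower interval starts so far left that the profile vanishes at its bottom
    end, even after the shift by \<open>k\<close>.\<close>
  have "profile n (- real k + min u 0 + k) = 0" "profile n (- real k + min u 0) = 0"
    by (intro profile_eq_0; simp)+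
  then show ?thesis
    using profile_increments[of "- real k + min u 0" u u v n k] assms
    by (simp add: algebra_simps)
qed

section \<open>Neighbourhoods in the cube and vertex isoperimetry\<close>

text \<open>The coordinate set is a parameter because the induction removes coordinates one by one.
  Including \<open>P\<close> makes the r-fold iterate a closed r-neighbourhood.\<close>

definition nbhd :: "'a set \<Rightarrow> 'a set set \<Rightarrow> 'a set set" where
  "nbhd S P = P \<union> (\<Union>y\<in>S. insert y ` P) \<union> (\<Union>y\<in>S. (\<lambda>A. A - {y}) ` P)"

lemma nbhd_subset_Pow: "P \<subseteq> Pow S \<Longrightarrow> nbhd S P \<subseteq> Pow S"
  by (auto simp: nbhd_def)

lemma subset_nbhd: "P \<subseteq> nbhd S P"
  by (auto simp: nbhd_def)

lemma nbhd_mono: "P \<subseteq> Q \<Longrightarrow> S \<subseteq> T \<Longrightarrow> nbhd S P \<subseteq> nbhd T Q"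
  unfolding nbhd_def by (intro Un_mono UN_mono image_mono) auto

lemma nbhd_distance: "C \<in> nbhd S P \<Longrightarrow> \<exists>D\<in>P. \<exists>y. D - C \<subseteq> {y}"
  unfolding nbhd_def by blast

lemma inj_on_insert_Pow: "x \<notin> T \<Longrightarrow> inj_on (insert x) (Pow T)"
  by (rule inj_onI) (metis PowD insert_ident subsetD)

lemma card_split_le:
  assumes "finite N" "X \<subseteq> Pow T" "Y \<subseteq> Pow T" "x \<notin> T" "X \<subseteq> N" "insert x ` Y \<subseteq> N"
  shows "card X + card Y \<le> card N"
proof -
  have "inj_on (insert x) Y"
    using inj_on_insert_Pow assms inj_on_subset by metis
  then have "card Y = card (insert x ` Y)" by (simp add: card_image)
  moreover have "X \<inter> insert x ` Y = {}" using assms by auto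
  ultimately have "card X + card Y = card (X \<union> insert x ` Y)"
    using assms by (simp add: card_Un_disjoint finite_subset)
  also have "\<dots> \<le> card N" using assms by (intro card_mono) auto
  finally show ?thesis .
qed

lemma card_split:
  assumes "finite T" "P \<subseteq> Pow (insert x T)" "x \<notin> T"
  shows "card P = card {A \<in> P. x \<notin> A} + card {A \<in> Pow T. insert x A \<in> P}"
proof -
  have P: "P = {A \<in> P. x \<notin> A} \<union> insert x ` {A \<in> Pow T. insert x A \<in> P}" (is "_ = ?X \<union> ?Y")
  proof (intro equalityI subsetI)
    fix A assume A: "A \<in> P"
    show "A \<in> ?X \<union> ?Y"
    proof (cases "x \<in> A")
      case True
      then have "A = insert x (A - {x})" by auto
      moreover have "A - {x} \<in> {A \<in> Pow T. insert x A \<in> P}"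
        using A True assms by (auto simp: insert_absorb)
      ultimately show ?thesis by blast
    qed (use A in auto)
  qed auto
  have "finite P" using assms finite_subset by blast
  then have "finite ?X" "finite ?Y" using assms by auto
  then have "card (?X \<union> ?Y) = card ?X + card ?Y" by (intro card_Un_disjoint) auto
  then have "card P = card ?X + card ?Y" using P by argo
  moreover have "inj_on (insert x) {A \<in> Pow T. insert x A \<in> P}"
    using inj_on_insert_Pow[OF assms(3)] by (rule inj_on_subset) auto
  ultimately show ?thesis by (simp add: card_image)
qed

text \<open>A vertex-isoperimetric inequality of Harper type. For \<open>j = 0\<close> the bound is
  attained by Hamming balls, for \<open>j = 1\<close> by products of a ball with an edge.\<close>

lemma isoperimetry:
  assumes "finite S" "card S = n + j" "j \<le> 1" "P \<subseteq> Pow S" "P \<noteq> {}"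
    and "2 ^ j * profile n u \<le> card P"
  shows "2 ^ j * profile n (u + 1) \<le> card (nbhd S P)"
  using assms
proof (induction n arbitrary: S P u)
  case 0
  \<comment> \<open>The base cube is a point or an edge, where the neighbourhood of any nonempty
    family is everything; \<open>profile 0\<close> never exceeds 1.\<close>
  have "2 ^ j \<le> card (nbhd S P)"
  proof (cases j)
    case 0
    then have "nbhd S P \<noteq> {}" "finite (nbhd S P)"
      using \<open>P \<noteq> {}\<close> nbhd_subset_Pow[OF \<open>P \<subseteq> Pow S\<close>] \<open>finite S\<close>
      by (auto simp: nbhd_def intro: finite_subset)
    then show ?thesis using 0 by (simp add: Suc_le_eq card_gt_0_iff)
  next
    case (Suc i)
    then have "card S = 1" "j = 1" using 0 by auto
    then obtain x where S: "S = {x}" by (auto simp: card_1_singleton_iff)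
    have "nbhd S P = {{}, {x}}"
      using 0 unfolding S nbhd_def by auto
    then show ?thesis using \<open>j = 1\<close> by simp
  qed
  then have "2 ^ j \<le> real (card (nbhd S P))"
    by (metis of_nat_le_iff of_nat_numeral of_nat_power)
  moreover have "2 ^ j * profile 0 (u + 1) \<le> 2 ^ j" by simp
  ultimately show ?case by linarith
next
  case (Suc n)
  obtain x T where S: "S = insert x T" and x: "x \<notin> T" and cT: "card T = n + j"
    using Suc.prems(2) by (auto simp: card_Suc_eq)
  have fT: "finite T" using Suc.prems S by auto
  let ?c = "\<lambda>u. 2 ^ j * profile n u"
  define P0 where "P0 = {A \<in> P. x \<notin> A}"
  define P1 where "P1 = {A \<in> Pow T. insert x A \<in> P}"
  have sub: "P0 \<subseteq> Pow T" "P1 \<subseteq> Pow T" using Suc.prems S by (auto simp: P0_def P1_def)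
  have cP: "card P = card P0 + card P1"
    unfolding P0_def P1_def using card_split[of T P x] fT x Suc.prems S by simp
  \<comment> \<open>\<open>X\<close> is the larger section. If it reaches \<open>?c u\<close>, its
    neighbourhood together with its own copy across \<open>x\<close> suffices; otherwise the
    neighbourhoods of both sections are needed.\<close>
  have core: "?c (u + 1) + ?c u \<le> card (nbhd T X) + card X
            \<or> ?c (u + 1) + ?c u \<le> card (nbhd T X) + card (nbhd T Y)"
    if XY: "X \<subseteq> Pow T" "Y \<subseteq> Pow T" "card Y \<le> card X" "card P = card X + card Y" for X Y
  proof -
    have fin: "finite X" "finite Y" using XY fT by (auto intro: finite_subset)
    have "card P > 0" using Suc.prems by (metis card_gt_0_iff finite_Pow_iff finite_subset)
    then have "X \<noteq> {}" using XY by auto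
    have total: "?c u + ?c (u - 1) \<le> card X + card Y"
      using Suc.prems XY by (simp add: algebra_simps)
    show ?thesis
    proof (cases "?c u \<le> card X")
      case True
      then show ?thesis using Suc.IH[OF fT cT \<open>j \<le> 1\<close> XY(1) \<open>X \<noteq> {}\<close>] by fastforce
    next
      case False
      have "card X \<le> 2 ^ (n + j)" using card_mono[OF _ XY(1)] fT cT by (simp add: card_Pow)
      then have X_le: "real (card X) / 2 ^ j \<le> 2 ^ n"
        by (simp add: field_simps power_add flip: of_nat_le_iff[where 'a = real])
      obtain v where v: "profile n v = real (card X) / 2 ^ j"
        using profile_surj[of "real (card X) / 2 ^ j" n] X_le by auto
      moreover have "real (card Y) / 2 ^ j \<le> real (card X) / 2 ^ j"
        using XY by (simp add: divide_right_mono)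
      ultimately obtain w where w: "profile n w = real (card Y) / 2 ^ j"
        using profile_surj[of "real (card Y) / 2 ^ j" n] X_le by force
      have *: "?c v = card X" "?c w = card Y" using v w by auto
      \<comment> \<open>Since \<open>X\<close> falls short of \<open>?c u\<close>, the total forces
        \<open>Y\<close> above \<open>?c (u - 1)\<close>; in particular \<open>Y\<close> is nonempty
        and the induction hypothesis covers it.\<close>
      have "?c w > ?c (u - 1)" using total False * by linarith
      then have w_gt: "profile n (u - 1) < profile n w" by simp
      then have "card Y > 0" using w profile_nonneg[of n "u - 1"] by (auto intro: ccontr)
      then have "Y \<noteq> {}" by auto
      have "?c v < ?c u" using False * by linarith
      then have "profile n v < profile n u" by simp
      then have "v \<le> u" using profile_mono[of u v n] by linarith
      \<comment> \<open>The profile has flat ends, so preimages are not unique and w may exceed v.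
        Lowering it to v then keeps its value.\<close>
      define w' where "w' = min w v"
      have w': "profile n w' = profile n w"
      proof (cases "w \<le> v")
        case False
        then have "profile n v \<le> profile n w" by (simp add: profile_mono)
        moreover have "profile n w \<le> profile n v"
          using v w XY(3) by (simp add: divide_right_mono)
        ultimately show ?thesis using False by (simp add: w'_def)
      qed (simp add: w'_def)
      have "2 ^ j * (profile n u + profile n (u - 1)) \<le> 2 ^ j * (profile n v + profile n w')"
        using total * w' by (simp add: distrib_left)
      then have "profile n (u + 1) + profile n u \<le> profile n (v + 1) + profile n (w' + 1)"
        using w_gt w' \<open>v \<le> u\<close> by (intro profile_exchange) (auto simp: w'_def)
      then have "2 ^ j * (profile n (u + 1) + profile n u)
          \<le> 2 ^ j * (profile n (v + 1) + profile n (w' + 1))" by simp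
      moreover have "?c (v + 1) \<le> card (nbhd T X)"
        using Suc.IH[OF fT cT \<open>j \<le> 1\<close> XY(1) \<open>X \<noteq> {}\<close>] * by simp
      moreover have "?c (w' + 1) \<le> card (nbhd T Y)"
        using Suc.IH[OF fT cT \<open>j \<le> 1\<close> XY(2) \<open>Y \<noteq> {}\<close>] * w' by simp
      ultimately show ?thesis by (simp add: distrib_left)
    qed
  qed
  \<comment> \<open>Within \<open>nbhd S P\<close>, the section without \<open>x\<close> contains
    \<open>nbhd T P0\<close> and \<open>P1\<close>, and the section with \<open>x\<close> contains
    \<open>nbhd T P1\<close> and \<open>P0\<close>. Choosing one from each gives the three bounds in
    \<open>le\<close>.\<close>
  have fN: "finite (nbhd S P)"
    using nbhd_subset_Pow[OF Suc.prems(4)] \<open>finite S\<close> by (auto intro: finite_subset)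
  have nT: "nbhd T P0 \<subseteq> Pow T" "nbhd T P1 \<subseteq> Pow T" by (intro nbhd_subset_Pow sub)+
  have "P0 \<subseteq> P" by (auto simp: P0_def)
  then have "nbhd T P0 \<subseteq> nbhd S P" "P0 \<subseteq> nbhd S P"
    using nbhd_mono[of P0 P T S] subset_nbhd[of P S] S by auto
  moreover have "insert x ` P0 \<subseteq> nbhd S P"
    using S by (auto simp: P0_def nbhd_def)
  moreover have "insert x ` P1 \<subseteq> nbhd S P" "P1 \<subseteq> nbhd S P"
  proof -
    show "insert x ` P1 \<subseteq> nbhd S P" by (auto simp: P1_def nbhd_def)
    show "P1 \<subseteq> nbhd S P"
    proof
      fix A assume "A \<in> P1"
      then have "insert x A \<in> P" "A = insert x A - {x}" using x by (auto simp: P1_def)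
      then show "A \<in> nbhd S P" unfolding nbhd_def S by blast
    qed
  qed
  moreover have "insert x ` nbhd T P1 \<subseteq> nbhd S P"
  proof
    fix B assume "B \<in> insert x ` nbhd T P1"
    then obtain C where C: "C \<in> nbhd T P1" "B = insert x C" by auto
    then consider "C \<in> P1" | y A where "A \<in> P1" "y \<in> T" "C = insert y A"
      | y A where "A \<in> P1" "y \<in> T" "C = A - {y}"
      unfolding nbhd_def by auto
    then show "B \<in> nbhd S P"
    proof cases
      case 1
      then show ?thesis using C by (auto simp: P1_def nbhd_def)
    next
      case 2
      then have "B = insert y (insert x A)" "insert x A \<in> P" using C by (auto simp: P1_def)
      then show ?thesis using 2 S unfolding nbhd_def by blast
    next
      case 3
      then have "B = insert x A - {y}" "insert x A \<in> P" using C x by (auto simp: P1_def)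
      then show ?thesis using 3 S unfolding nbhd_def by blast
    qed
  qed
  ultimately have le:
    "card (nbhd T P0) + card P0 \<le> card (nbhd S P)"
    "card P1 + card (nbhd T P1) \<le> card (nbhd S P)"
    "card (nbhd T P0) + card (nbhd T P1) \<le> card (nbhd S P)"
    using card_split_le[OF fN nT(1) sub(1) x] card_split_le[OF fN sub(2) nT(2) x]
      card_split_le[OF fN nT(1) nT(2) x] by simp_all
  have "?c (u + 1) + ?c u \<le> card (nbhd S P)"
  proof (cases "card P0 \<le> card P1")
    case True
    then show ?thesis using core[OF sub(2,1)] cP le(2,3) by linarith
  next
    case False
    then show ?thesis using core[OF sub] cP le(1,3) by linarith
  qed
  then have "2 ^ j * (profile n (u + 1) + profile n u) \<le> card (nbhd S P)"
    by (simp only: distrib_left)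
  moreover have "profile (Suc n) (u + 1) = profile n (u + 1) + profile n u" by simp
  ultimately show ?case by simp
qed

lemma isoperimetry_iter:
  assumes "finite S" "card S = n + j" "j \<le> 1" "P \<subseteq> Pow S" "P \<noteq> {}"
    and "2 ^ j * profile n u \<le> card P"
  shows "(nbhd S ^^ r) P \<subseteq> Pow S \<and> (nbhd S ^^ r) P \<noteq> {}
    \<and> 2 ^ j * profile n (u + r) \<le> card ((nbhd S ^^ r) P)"
proof (induction r)
  case (Suc r)
  then have "2 ^ j * profile n (u + r + 1) \<le> card (nbhd S ((nbhd S ^^ r) P))"
    using isoperimetry assms by blast
  moreover have "nbhd S ((nbhd S ^^ r) P) \<noteq> {}" using Suc subset_nbhd by blast
  ultimately show ?case using Suc nbhd_subset_Pow[of "(nbhd S ^^ r) P" S] by (simp add: add_ac)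
qed (use assms in auto)

text \<open>Counting only lost elements is enough: for C = S - B the difference A - C is the
  intersection of A and B.\<close>

lemma nbhd_iter_distance:
  assumes "P \<subseteq> Pow S" "finite S" "C \<in> (nbhd S ^^ r) P"
  shows "\<exists>A\<in>P. card (A - C) \<le> r"
  using assms(3)
proof (induction r arbitrary: C)
  case (Suc r)
  then obtain D y where D: "D \<in> (nbhd S ^^ r) P" "D - C \<subseteq> {y}"
    using nbhd_distance by fastforce
  then obtain A where A: "A \<in> P" "card (A - D) \<le> r" using Suc.IH by blast
  have fin: "finite (A - D)" using A assms by (auto intro: finite_subset)
  have "card (A - C) \<le> card (insert y (A - D))"
    using D fin by (intro card_mono) auto
  also have "\<dots> \<le> Suc r" using A fin by (simp add: card_insert_if)
  finally show ?case using A by blast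
next
  case 0
  then show ?case by (auto intro!: bexI[of _ C])
qed

section \<open>From isoperimetry to cross-intersecting families\<close>

text \<open>With p = |P|, q = |Q| and W = 2^|S|, the second bound says k/W <= (k - p)/(q - p) when q
  > p, the form needed for \<open>beta\<close>. The first, taken with P = Q, bounds intersecting
  families. The choice of \<open>v\<close> makes its shift by t - 1 equal to its reflection.\<close>

lemma cross_intersecting_bound:
  assumes S: "finite S" "card S = n + j" "j \<le> 1" and "1 \<le> t"
    and PQ: "P \<subseteq> Q" "Q \<subseteq> Pow S" "\<And>A B. A \<in> P \<Longrightarrow> B \<in> Q \<Longrightarrow> t \<le> card (A \<inter> B)"
    and v: "2 * v = real n + 2 - real t" and k: "k = 2 ^ j * profile n v" "0 < k"
  shows "real (card P) \<le> k"
    and "2 ^ card S * card P + k * (real (card Q) - card P) \<le> k * 2 ^ card S"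
proof -
  have "real (card P) \<le> k \<and> 2 ^ card S * card P + k * (real (card Q) - card P) \<le> k * 2 ^ card S"
  proof (cases "P = {}")
    case True
    have "card Q \<le> 2 ^ card S"
      using card_mono[OF _ PQ(2)] S by (simp add: card_Pow)
    then have "real (card Q) \<le> 2 ^ card S"
      by (metis of_nat_le_iff of_nat_numeral of_nat_power)
    then show ?thesis using True k(2) mult_left_mono[of "real (card Q)" "2 ^ card S" k] by simp
  next
    case False
    define N where "N = (nbhd S ^^ (t - 1)) P"
    define W :: real where "W = 2 ^ card S"
    have W: "W = 2 ^ j * 2 ^ n" by (simp add: W_def S power_add)
    have PS: "P \<subseteq> Pow S" using PQ by auto
    have "card P \<le> 2 ^ card S" using card_mono[OF _ PS] S by (simp add: card_Pow)
    then have "real (card P) \<le> 2 ^ card S"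
      by (metis of_nat_le_iff of_nat_numeral of_nat_power)
    then have "real (card P) / 2 ^ j \<le> 2 ^ n" by (simp add: field_simps S power_add)
    then obtain u where u: "profile n u = real (card P) / 2 ^ j"
      using profile_surj[of "real (card P) / 2 ^ j" n] by auto
    then have uP: "2 ^ j * profile n u = card P" by simp
    have N: "N \<subseteq> Pow S" "2 ^ j * profile n (u + (t - 1)) \<le> card N"
      using isoperimetry_iter[OF S PS False, of u "t - 1"] uP by (auto simp: N_def)
    \<comment> \<open>Hence the bound on the (t - 1)-neighbourhood of a family of size k is exactly
      W - k.\<close>
    have "v + (t - 1) = real n + 1 - v" using v \<open>1 \<le> t\<close> by (simp add: of_nat_diff)
    then have "profile n (v + (t - 1)) = 2 ^ n - profile n v"
      using profile_reflect by metis
    then have v': "2 ^ j * profile n (v + (t - 1)) = W - k"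
      unfolding W k by (simp only: right_diff_distrib)
    have fin: "finite N" "finite Q" using N PQ S by (auto intro: finite_subset)
    have inj: "inj_on (\<lambda>B. S - B) Q"
      by (rule inj_onI) (use PQ in blast)
    have "N \<inter> (\<lambda>B. S - B) ` Q = {}"
    proof (rule ccontr)
      assume "N \<inter> (\<lambda>B. S - B) ` Q \<noteq> {}"
      then obtain B where B: "B \<in> Q" "S - B \<in> N" by auto
      then obtain A where A: "A \<in> P" "card (A - (S - B)) \<le> t - 1"
        using nbhd_iter_distance[OF PS \<open>finite S\<close>] N_def by blast
      moreover have "A - (S - B) = A \<inter> B" using A B PS by auto
      ultimately show False using PQ(3)[OF A(1) B(1)] \<open>1 \<le> t\<close> by simp
    qed
    then have "card N + card Q = card (N \<union> (\<lambda>B. S - B) ` Q)"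
      using fin inj by (simp add: card_Un_disjoint card_image)
    also have "\<dots> \<le> card (Pow S)"
      using N S by (intro card_mono) auto
    finally have "card N + card Q \<le> 2 ^ card S" using S by (simp add: card_Pow)
    then have NQ: "real (card N) + card Q \<le> W"
      unfolding W_def by (metis of_nat_add of_nat_le_iff of_nat_numeral of_nat_power)
    have "card P \<le> card Q" using PQ fin by (simp add: card_mono)
    \<comment> \<open>If |P| > k, then |N| >= W - k while |Q| >= |P| > k, so \<open>N\<close> and
      the complements of \<open>Q\<close> no longer fit disjointly into the cube.\<close>
    have p_le: "real (card P) \<le> k"
    proof (rule ccontr)
      assume *: "\<not> real (card P) \<le> k"
      then have "2 ^ j * profile n v < 2 ^ j * profile n u" using uP k by linarith
      then have "profile n v < profile n u" by simp
      then have "v \<le> u" using profile_mono[of u v n] by linarith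
      then have "profile n (v + (t - 1)) \<le> profile n (u + (t - 1))" by (simp add: profile_mono)
      then have "2 ^ j * profile n (v + (t - 1)) \<le> 2 ^ j * profile n (u + (t - 1))" by simp
      moreover have "real (card P) \<le> card Q" using \<open>card P \<le> card Q\<close> by simp
      ultimately show False using * v' N(2) NQ by linarith
    qed
    \<comment> \<open>This is \<open>profile_ratio\<close> between u and v with shift t - 1, both
      sides scaled by 4^j. Again a minimum repairs a possibly ill-placed preimage.\<close>
    have ratio: "(W - k) * card P \<le> k * card N"
    proof -
      define u' where "u' = min u v"
      have "2 ^ j * profile n u \<le> 2 ^ j * profile n v" using p_le uP k by linarith
      then have "profile n u \<le> profile n v" by simp
      then have "profile n u' = profile n u"
        using profile_mono[of v u n] by (cases "u \<le> v") (simp_all add: u'_def)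
      then have u': "profile n u' = profile n u" "u' \<le> v" "u' \<le> u" by (simp_all add: u'_def)
      have "(W - k) * card P = 2 ^ j * 2 ^ j * (profile n (v + (t - 1)) * profile n u')"
        unfolding v'[symmetric] uP[symmetric] u' by simp
      also have "\<dots> \<le> 2 ^ j * 2 ^ j * (profile n v * profile n (u' + (t - 1)))"
        using profile_ratio[OF u'(2)] by (intro mult_left_mono) auto
      also have "\<dots> = k * (2 ^ j * profile n (u' + (t - 1)))" by (simp add: k)
      also have "\<dots> \<le> k * card N"
      proof (rule mult_left_mono)
        have "2 ^ j * profile n (u' + (t - 1)) \<le> 2 ^ j * profile n (u + (t - 1))"
          using u' by (simp add: profile_mono)
        then show "2 ^ j * profile n (u' + (t - 1)) \<le> card N" using N by linarith
      qed (use k in simp)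
      finally show ?thesis .
    qed
    have "k * card N \<le> k * (W - card Q)" using NQ k by (intro mult_left_mono) auto
    with ratio p_le show ?thesis by (simp add: W_def[symmetric] algebra_simps)
  qed
  then show "real (card P) \<le> k"
    and "2 ^ card S * card P + k * (real (card Q) - card P) \<le> k * 2 ^ card S" by auto
qed

section \<open>The families \<open>K_fam\<close>: size and intersection\<close>

text \<open>For m <= |S| these sets form the ball of radius |S| - m about \<open>S\<close>;
  splitting along one element reproduces Pascal's rule.\<close>

lemma card_large_subsets:
  assumes "finite S"
  shows "real (card {A \<in> Pow S. m \<le> card A}) = profile (card S) (real (card S) + 1 - real m)"
  using assms
proof (induction S arbitrary: m)
  case empty
  have "{A \<in> Pow {}. m \<le> card A} = (if m = 0 then {{}} else {})" by auto
  then have "real (card {A \<in> Pow {}. m \<le> card A}) = (if m = 0 then 1 else 0)" by simp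
  then show ?case by (cases m) simp_all
next
  case (insert x T)
  let ?P = "{A \<in> Pow (insert x T). m \<le> card A}"
  have "{A \<in> ?P. x \<notin> A} = {A \<in> Pow T. m \<le> card A}"
    using insert.hyps by auto
  moreover have "{A \<in> Pow T. insert x A \<in> ?P} = {A \<in> Pow T. m - 1 \<le> card A}"
  proof -
    have "card (insert x A) = Suc (card A)" if "A \<subseteq> T" for A
      using that insert.hyps finite_subset by (intro card_insert_disjoint) auto
    then show ?thesis by auto
  qed
  ultimately have "card ?P = card {A \<in> Pow T. m \<le> card A} + card {A \<in> Pow T. m - 1 \<le> card A}"
    using card_split[of T ?P x] insert.hyps by (metis (no_types, lifting) mem_Collect_eq subsetI)
  then have *: "real (card ?P) = profile (card T) (real (card T) + 1 - real m)
      + profile (card T) (real (card T) + 1 - real (m - 1))"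
    using insert.IH by simp
  \<comment> \<open>For m = 0 truncated subtraction keeps \<open>m - 1\<close> at 0, but there the
    profile is already saturated, so the recursion still fits.\<close>
  show ?case
    unfolding * using insert
    by (cases m) (simp_all add: profile_eq_power algebra_simps)
qed

lemma finite_K_fam: "finite (K_fam n t)"
  by (rule finite_subset[of _ "Pow {1..n}"]) (auto simp: K_fam_def)

lemma top_in_K_fam:
  assumes "1 \<le> t" "t \<le> n"
  shows "{1..n} \<in> K_fam n t"
proof -
  have "{1..n} \<inter> {1..n - 1} = {1..n - 1}" by auto
  \<comment> \<open>Parity excludes t = n here, so t <= n - 1.\<close>
  moreover have "n + t - 1 \<le> 2 * (n - 1)" if "odd (n + t)"
    using that assms by (cases "t = n") auto
  ultimately show ?thesis using assms by (auto simp: K_fam_def)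
qed

lemma card_inter_ge:
  assumes "finite S" "A \<subseteq> S" "B \<subseteq> S"
  shows "card A + card B \<le> card S + card (A \<inter> B)"
  using card_Un_Int[of A B] card_mono[of S "A \<union> B"] assms by (simp add: finite_subset)

lemma K_fam_t_intersecting: "t_intersecting t (K_fam n t)"
  unfolding t_intersecting_def
proof (intro ballI impI)
  fix A B assume AB: "A \<in> K_fam n t" "B \<in> K_fam n t" "A \<noteq> B"
  show "t \<le> card (A \<inter> B)"
  proof (cases "even (n + t)")
    case True
    then show ?thesis using AB card_inter_ge[of "{1..n}" A B] by (auto simp: K_fam_def)
  next
    case False
    have sub: "A \<subseteq> {1..n}" "B \<subseteq> {1..n}" using AB False by (auto simp: K_fam_def)
    have "n \<ge> 1"
      using sub AB(3) by (cases n) auto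
    have "card (A \<inter> {1..n-1}) + card (B \<inter> {1..n-1})
        \<le> n - 1 + card ((A \<inter> {1..n-1}) \<inter> (B \<inter> {1..n-1}))"
      using card_inter_ge[of "{1..n-1}" "A \<inter> {1..n-1}" "B \<inter> {1..n-1}"] by simp
    also have "card ((A \<inter> {1..n-1}) \<inter> (B \<inter> {1..n-1})) \<le> card (A \<inter> B)"
      using sub by (intro card_mono) (auto intro: finite_subset)
    finally have "card (A \<inter> {1..n-1}) + card (B \<inter> {1..n-1}) \<le> n - 1 + card (A \<inter> B)"
      by simp
    moreover have "n + t - 1 \<le> 2 * card (A \<inter> {1..n-1})" "n + t - 1 \<le> 2 * card (B \<inter> {1..n-1})"
      using AB False by (auto simp: K_fam_def)
    ultimately show ?thesis using \<open>n \<ge> 1\<close> by linarith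
  qed
qed

text \<open>For even n + t the family is a ball about [n], with j = 0. For odd n + t the element n
  is unconstrained, so the family is a ball in dimension n - 1 times an edge, with j = 1. Both times
  \<open>v\<close> satisfies the reflection condition of
  \<open>cross_intersecting_bound\<close>.\<close>

lemma card_K_fam:
  assumes "1 \<le> t" "t \<le> n"
  obtains n' j v where "n = n' + j" "j \<le> 1" "2 * v = real n' + 2 - real t"
    "real (card (K_fam n t)) = 2 ^ j * profile n' v"
proof (cases "even (n + t)")
  case True
  then obtain m where m: "n + t = 2 * m" by (elim evenE)
  have "K_fam n t = {A \<in> Pow {1..n}. m \<le> card A}" using True m by (auto simp: K_fam_def)
  then have "real (card (K_fam n t)) = profile n (real n + 1 - real m)"
    using card_large_subsets[of "{1..n}" m] by simp
  moreover have "2 * (real n + 1 - real m) = real n + 2 - real t"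
    using m by (simp add: algebra_simps)
  ultimately show ?thesis using that[of n 0 "real n + 1 - real m"] by simp
next
  case False
  then obtain m where m: "n + t = 2 * m + 1" by (elim oddE)
  obtain n' where n: "n = Suc n'" using assms by (cases n) auto
  define T where "T = {1..n'}"
  have T: "n \<notin> T" "finite T" "card T = n'" using n by (auto simp: T_def)
  let ?L = "{A \<in> Pow T. m \<le> card A}"
  have "{1..n} = insert n T" using n by (auto simp: T_def)
  then have K: "K_fam n t = {A \<in> Pow (insert n T). m \<le> card (A \<inter> T)}"
    using False m n by (auto simp: K_fam_def T_def)
  have inter: "A \<inter> T = A" "insert n A \<inter> T = A" "A \<subseteq> insert n T" "n \<notin> A"
    if "A \<subseteq> T" for A
    using that T by auto
  have "{A \<in> K_fam n t. n \<notin> A} = ?L"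
    unfolding K using inter by (auto simp: subset_insert)
  moreover have "{A \<in> Pow T. insert n A \<in> K_fam n t} = ?L"
    unfolding K using inter by auto
  moreover have "card (K_fam n t)
      = card {A \<in> K_fam n t. n \<notin> A} + card {A \<in> Pow T. insert n A \<in> K_fam n t}"
    by (rule card_split) (use K T in auto)
  ultimately have "real (card (K_fam n t)) = 2 ^ 1 * profile n' (real n' + 1 - real m)"
    using card_large_subsets[of T m] T by simp
  moreover have "2 * (real n' + 1 - real m) = real n' + 2 - real t"
  proof -
    have "n' + t = 2 * m" using m n by simp
    then have "real n' + real t = 2 * real m" by (metis of_nat_add of_nat_mult of_nat_numeral)
    then show ?thesis by simp
  qed
  ultimately show ?thesis using that[of n' 1 "real n' + 1 - real m"] n by simp
qed

lemma K_fam_cross_bound: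
  assumes "1 \<le> t" "t \<le> n" "P \<subseteq> Q" "Q \<subseteq> Pow {1..n}"
    "\<And>A B. A \<in> P \<Longrightarrow> B \<in> Q \<Longrightarrow> t \<le> card (A \<inter> B)"
  shows "card P \<le> card (K_fam n t)"
    and "2 ^ n * card P + real (card (K_fam n t)) * (real (card Q) - card P)
        \<le> card (K_fam n t) * 2 ^ n"
proof -
  obtain n' j v where *: "n = n' + j" "j \<le> 1" "2 * v = real n' + 2 - real t"
    "real (card (K_fam n t)) = 2 ^ j * profile n' v"
    using card_K_fam[OF assms(1,2)] .
  have "0 < real (card (K_fam n t))"
    using top_in_K_fam[OF assms(1,2)] finite_K_fam[of n t] by (auto simp: card_gt_0_iff)
  note bound = cross_intersecting_bound[of "{1..n}" n' j t P Q, OF _ _ *(2) assms(1,3,4,5) *(3,4) this]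
  show "card P \<le> card (K_fam n t)"
    using bound(1) * by simp
  show "2 ^ n * card P + real (card (K_fam n t)) * (real (card Q) - card P)
        \<le> card (K_fam n t) * 2 ^ n"
    using bound(2) * by simp
qed

section \<open>The values of \<open>l_max\<close> and \<open>beta\<close>\<close>

lemma l_max_eq_card_K_fam:
  assumes "1 \<le> t" "t \<le> n"
  shows "l_max (Pow {1..n}) t = card (K_fam n t)"
  unfolding l_max_def
proof (rule Max_eqI)
  let ?X = "{card \<A> | \<A>. \<A> \<subseteq> Pow {1..n} \<and> t_intersecting t \<A>}"
  have "?X \<subseteq> card ` Pow (Pow {1..n})" by auto
  then show "finite ?X" by (rule finite_subset) simp
  have "K_fam n t \<subseteq> Pow {1..n}" by (auto simp: K_fam_def)
  then show "card (K_fam n t) \<in> ?X" using K_fam_t_intersecting by blast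
next
  fix y assume "y \<in> {card \<A> | \<A>. \<A> \<subseteq> Pow {1..n} \<and> t_intersecting t \<A>}"
  then obtain \<A> where A: "y = card \<A>" "\<A> \<subseteq> Pow {1..n}" "t_intersecting t \<A>" by auto
  have fin: "finite \<A>" using A by (auto intro: finite_subset)
  show "y \<le> card (K_fam n t)"
  proof (cases "card \<A> \<le> 1")
    case True
    have "0 < card (K_fam n t)"
      using top_in_K_fam[OF assms] finite_K_fam[of n t] by (auto simp: card_gt_0_iff)
    then show ?thesis using True A by simp
  next
    case False
    \<comment> \<open>The cross bound also asks for |B| >= t, which \<open>t_intersecting\<close>
      does not demand. A second member D supplies it, hence the separate treatment of families with
      at most one member.\<close>
    have "t \<le> card (B \<inter> C)" if BC: "B \<in> \<A>" "C \<in> \<A>" for B C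
    proof (cases "B = C")
      case True
      have "\<not> \<A> \<subseteq> {B}" using False card_mono[of "{B}" \<A>] by auto
      then obtain D where D: "D \<in> \<A>" "D \<noteq> B" by auto
      then have "t \<le> card (B \<inter> D)" using A(3) BC by (auto simp: t_intersecting_def)
      also have "\<dots> \<le> card (B \<inter> C)"
        using True BC A(2) by (intro card_mono) (auto intro: finite_subset)
      finally show ?thesis .
    qed (use A(3) BC in \<open>auto simp: t_intersecting_def\<close>)
    then show ?thesis using K_fam_cross_bound(1)[OF assms, of \<A> \<A>] A by blast
  qed
qed

lemma beta_sub_ge:
  assumes "1 \<le> t" "t \<le> n" "\<A> \<subseteq> Pow {1..n}"
  shows "real (card (K_fam n t)) / 2 ^ n \<le> beta_sub (Pow {1..n}) t \<A>"
proof (cases "fam_minus \<A> t = {}")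
  case True
  then show ?thesis
    using l_max_eq_card_K_fam[OF assms(1,2)] by (simp add: beta_sub_def card_Pow)
next
  case False
  let ?P = "fam_plus \<A> t" and ?M = "fam_minus \<A> t"
  have fin: "finite \<A>" using assms by (auto intro: finite_subset)
  have sub: "?P \<subseteq> \<A>" by (auto simp: fam_plus_def)
  have cM: "real (card ?M) = real (card \<A>) - card ?P"
    using fin sub card_mono[OF fin sub]
    by (simp add: fam_minus_def card_Diff_subset finite_subset of_nat_diff)
  have "finite ?M" using fin by (simp add: fam_minus_def)
  then have pos: "card ?M > 0" using False by (simp add: card_gt_0_iff)
  \<comment> \<open>The diagonal case again needs a further member of the family; any element of
    \<open>fam_minus\<close> differs from A and serves.\<close>
  have "t \<le> card (A \<inter> B)" if AB: "A \<in> ?P" "B \<in> \<A>" for A B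
  proof (cases "B = A")
    case True
    obtain D where "D \<in> ?M" using False by auto
    then have "D \<in> \<A> - {A}" using AB by (auto simp: fam_minus_def)
    then have "t \<le> card (A \<inter> D)" using AB by (auto simp: fam_plus_def)
    also have "\<dots> \<le> card (A \<inter> B)"
      using True AB assms(3) by (intro card_mono) (auto intro: finite_subset)
    finally show ?thesis .
  qed (use AB in \<open>auto simp: fam_plus_def\<close>)
  then have "2 ^ n * card ?P + real (card (K_fam n t)) * card ?M \<le> card (K_fam n t) * 2 ^ n"
    using K_fam_cross_bound(2)[OF assms(1,2) sub assms(3)] cM by simp
  then show ?thesis
    using False pos l_max_eq_card_K_fam[OF assms(1,2)] by (simp add: beta_sub_def field_simps)
qed

theorem theorem3p10:
  fixes n t :: nat
  assumes "1 \<le> t" and "t \<le> n"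
  shows "beta (Pow {1..n}) t = real (l_max (Pow {1..n}) t) / real (card (Pow {1..n}))
       \<and> real (l_max (Pow {1..n}) t) / real (card (Pow {1..n})) = real (card (K_fam n t)) / 2 ^ n"
proof
  show ratio: "real (l_max (Pow {1..n}) t) / real (card (Pow {1..n})) = real (card (K_fam n t)) / 2 ^ n"
    using l_max_eq_card_K_fam[OF assms] by (simp add: card_Pow)
  show "beta (Pow {1..n}) t = real (l_max (Pow {1..n}) t) / real (card (Pow {1..n}))"
    unfolding beta_def
  proof (rule Min_eqI)
    let ?X = "{beta_sub (Pow {1..n}) t \<A> | \<A>. \<A> \<subseteq> Pow {1..n}}"
    have "?X \<subseteq> beta_sub (Pow {1..n}) t ` Pow (Pow {1..n})" by auto
    then show "finite ?X" by (rule finite_subset) simp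
    \<comment> \<open>The minimum is attained at the empty family through the default clause of
      \<open>beta_sub\<close>.\<close>
    have "beta_sub (Pow {1..n}) t {} = real (l_max (Pow {1..n}) t) / real (card (Pow {1..n}))"
      by (simp add: beta_sub_def fam_minus_def)
    then show "real (l_max (Pow {1..n}) t) / real (card (Pow {1..n})) \<in> ?X"
      by (intro CollectI exI[of _ "{}"]) simp
  next
    fix y assume "y \<in> {beta_sub (Pow {1..n}) t \<A> | \<A>. \<A> \<subseteq> Pow {1..n}}"
    then show "real (l_max (Pow {1..n}) t) / real (card (Pow {1..n})) \<le> y"
      unfolding ratio using beta_sub_ge[OF assms] by auto
  qed
qed

end
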